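(* Let $\mathfrak{g}$ be a finite-dimensional quadratic Lie algebra over $\mathbb{C}$. Let $\mathbf{x}$ be an element of $\mathfrak{g}_\infty$ and let $m$, $n$ be natural numbers with $m<n$. Then, for all elements $\mathbf{y}$ of $\mathfrak{g}_\infty$ such that $\mathbf{x}(m)=\mathbf{y}(m)$ and $\dim\mathfrak{g}_n^{\mathbf{y}(n)}=(n-m)\chi(\mathfrak{g})+\dim\mathfrak{g}_m^{\mathbf{x}(m)}$, and for all pairs of integers $(m',n')$ with $m\leq m'\leq n'$, $$\operatorname{mod}_{m',n'}(\mathbf{y})=(n'-m')\chi(\mathfrak{g}).$$
   Context: Natural numbers include $0$. A Lie algebra is quadratic if it admits a non-degenerate symmetric bilinear form $K$ that is invariant, i.e. $K([x,y],z)=K(x,[y,z])$ for all $x,y,z$. For a finite-dimensional complex Lie algebra $\mathfrak{g}$, let $\mathfrak{g}_\infty=\mathfrak{g}\otimes\mathbb{C}[T]$ be the Lie algebra with bracket extended $\mathbb{C}[T]$-bilinearly; its elements are written $\mathbf{x}=\sum_{k\in\mathbb{N}}x_k\otimes T^k$ with $x_k\in\mathfrak{g}$ (finitely many nonzero). For $m\in\mathbb{N}$ let $\mathfrak{g}_m=\mathfrak{g}_\infty/(\mathfrak{g}\otimes T^{m+1}\mathbb{C}[T])$ (the $m$-th generalized Takiff Lie algebra; $\mathfrak{g}_0=\mathfrak{g}$), and let $\mathbf{x}(m)=(x_0,\dots,x_m)$ be the image of $\mathbf{x}$ in $\mathfrak{g}_m$. For an element $z$ of a Lie algebra $\mathfrak{h}$,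 $\mathfrak{h}^z$ is its centralizer in $\mathfrak{h}$; for $f\in\mathfrak{h}^*$, $\mathfrak{h}^f=\{y\in\mathfrak{h}: f([y,\mathfrak{h}])=0\}$. The index of $\mathfrak{h}$ is $\chi(\mathfrak{h})=\min_{f\in\mathfrak{h}^*}\dim\mathfrak{h}^f$. For $m\le n$ in $\mathbb{N}$ and $\mathbf{x}\in\mathfrak{g}_\infty$, the $(m,n)$-modality of $\mathbf{x}$ is $$\operatorname{mod}_{m,n}(\mathbf{x})=\min_{\mathbf{y}\in\mathfrak{g}_\infty,\ \mathbf{y}(m)=\mathbf{x}(m)}\dim\mathfrak{g}_n^{\mathbf{y}(n)}-\dim\mathfrak{g}_m^{\mathbf{x}(m)}.$$ *)

theory Defs
  imports Complex_Main "HOL-Computational_Algebra.Polynomial"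
begin

section \<open>Lie algebras on subspaces of a complex vector space\<close>

definition linear_on ::
  "(complex \<Rightarrow> 'a::ab_group_add \<Rightarrow> 'a) \<Rightarrow> (complex \<Rightarrow> 'b::ab_group_add \<Rightarrow> 'b) \<Rightarrow> 'a set \<Rightarrow> ('a \<Rightarrow> 'b) \<Rightarrow> bool"
  where "linear_on s1 s2 L f \<longleftrightarrow>
    (\<forall>x\<in>L. \<forall>y\<in>L. f (x + y) = f x + f y) \<and> (\<forall>c. \<forall>x\<in>L. f (s1 c x) = s2 c (f x))"

locale lie_algebra = vector_space scale
  for scale :: "complex \<Rightarrow> 'a::ab_group_add \<Rightarrow> 'a" +
  fixes L :: "'a set" and br :: "'a \<Rightarrow> 'a \<Rightarrow> 'a"
  assumes subspace_carrier: "subspace L"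
    and br_closed: "x \<in> L \<Longrightarrow> y \<in> L \<Longrightarrow> br x y \<in> L"
    and br_linear_right: "x \<in> L \<Longrightarrow> linear_on scale scale L (br x)"
    and br_linear_left: "y \<in> L \<Longrightarrow> linear_on scale scale L (\<lambda>x. br x y)"
    and br_self: "x \<in> L \<Longrightarrow> br x x = 0"
    and jacobi: "x \<in> L \<Longrightarrow> y \<in> L \<Longrightarrow> z \<in> L \<Longrightarrow>
      br x (br y z) + br y (br z x) + br z (br x y) = 0"

definition invariant_form ::
  "(complex \<Rightarrow> 'a::ab_group_add \<Rightarrow> 'a) \<Rightarrow> 'a set \<Rightarrow> ('a \<Rightarrow> 'a \<Rightarrow> 'a) \<Rightarrow> ('a \<Rightarrow> 'a \<Rightarrow> complex) \<Rightarrow> bool"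
  where "invariant_form scale L br K \<longleftrightarrow>
    (\<forall>x\<in>L. linear_on scale (*) L (K x)) \<and> (\<forall>y\<in>L. linear_on scale (*) L (\<lambda>x. K x y)) \<and>
    (\<forall>x\<in>L. \<forall>y\<in>L. K x y = K y x) \<and>
    (\<forall>x\<in>L. \<forall>y\<in>L. \<forall>z\<in>L. K (br x y) z = K x (br y z))"

definition nondegenerate_form :: "'a::ab_group_add set \<Rightarrow> ('a \<Rightarrow> 'a \<Rightarrow> complex) \<Rightarrow> bool"
  where "nondegenerate_form L K \<longleftrightarrow> (\<forall>x\<in>L. (\<forall>y\<in>L. K x y = 0) \<longrightarrow> x = 0)"

locale quadratic_lie_algebra = lie_algebra +
  assumes quadratic: "\<exists>K. invariant_form scale L br K \<and> nondegenerate_form L K"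

definition centralizer :: "'a set \<Rightarrow> ('a \<Rightarrow> 'a \<Rightarrow> 'a::ab_group_add) \<Rightarrow> 'a \<Rightarrow> 'a set"
  where "centralizer L br z = {y\<in>L. br y z = 0}"

definition coadjoint_stabilizer ::
  "'a set \<Rightarrow> ('a \<Rightarrow> 'a \<Rightarrow> 'a::ab_group_add) \<Rightarrow> ('a \<Rightarrow> complex) \<Rightarrow> 'a set"
  where "coadjoint_stabilizer L br f = {y\<in>L. \<forall>z\<in>L. f (br y z) = 0}"

text \<open>An infimum of a nonempty set of natural numbers is its minimum (\<open>f = 0\<close> is always available).\<close>

definition index ::
  "(complex \<Rightarrow> 'a::ab_group_add \<Rightarrow> 'a) \<Rightarrow> 'a set \<Rightarrow> ('a \<Rightarrow> 'a \<Rightarrow> 'a) \<Rightarrow> nat"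
  where "index scale L br =
    (INF f\<in>{f. linear_on scale (*) L f}. vector_space.dim scale (coadjoint_stabilizer L br f))"


section \<open>Generalized Takiff algebras\<close>

text \<open>An element \<open>\<Sum>\<^sub>k x\<^sub>k \<otimes> T^k\<close> of \<open>\<gg> \<otimes> \<complex>[T]\<close> is the polynomial over the
  abelian group \<open>\<gg>\<close> with coefficients \<open>x\<^sub>k\<close>.\<close>

definition poly_scale :: "('k \<Rightarrow> 'a::ab_group_add \<Rightarrow> 'a) \<Rightarrow> 'k \<Rightarrow> 'a poly \<Rightarrow> 'a poly"
  where "poly_scale scale c = map_poly (scale c)"

definition poly_bracket :: "('a::ab_group_add \<Rightarrow> 'a \<Rightarrow> 'a) \<Rightarrow> 'a poly \<Rightarrow> 'a poly \<Rightarrow> 'a poly"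
  where "poly_bracket br p q =
    (\<Sum>i\<le>degree p. \<Sum>j\<le>degree q. monom (br (coeff p i) (coeff q j)) (i + j))"

text \<open>The quotient of \<open>\<gg> \<otimes> \<complex>[T]\<close> by \<open>\<gg> \<otimes> T^(m+1) \<complex>[T]\<close> is realized on the tuples
  \<open>(x\<^sub>0, \<dots>, x\<^sub>m)\<close>, that is, on the polynomials of degree at most \<open>m\<close>; the projection is
  truncation, and the bracket is the one induced along it. See \<open>takiff_quotient\<close> below.\<close>

definition takiff :: "nat \<Rightarrow> 'a::ab_group_add poly set"
  where "takiff m = {p. degree p \<le> m}"

definition jet :: "nat \<Rightarrow> 'a::ab_group_add poly \<Rightarrow> 'a poly"
  where "jet m = poly_cutoff (Suc m)"

definition takiff_bracket ::
  "('a::ab_group_add \<Rightarrow> 'a \<Rightarrow> 'a) \<Rightarrow> nat \<Rightarrow> 'a poly \<Rightarrow> 'a poly \<Rightarrow> 'a poly"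
  where "takiff_bracket br m p q = jet m (poly_bracket br p q)"

definition takiff_centralizer_dim ::
  "(complex \<Rightarrow> 'a::ab_group_add \<Rightarrow> 'a) \<Rightarrow> ('a \<Rightarrow> 'a \<Rightarrow> 'a) \<Rightarrow> nat \<Rightarrow> 'a poly \<Rightarrow> nat"
  where "takiff_centralizer_dim scale br m x =
    vector_space.dim (poly_scale scale) (centralizer (takiff m) (takiff_bracket br m) (jet m x))"

definition modality ::
  "(complex \<Rightarrow> 'a::ab_group_add \<Rightarrow> 'a) \<Rightarrow> ('a \<Rightarrow> 'a \<Rightarrow> 'a) \<Rightarrow> nat \<Rightarrow> nat \<Rightarrow> 'a poly \<Rightarrow> int"
  where "modality scale br m n x =
    int (INF y\<in>{y. jet m y = jet m x}. takiff_centralizer_dim scale br n y)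
    - int (takiff_centralizer_dim scale br m x)"


section \<open>The Takiff algebras are the quotient Lie algebras\<close>

lemma coeff_jet: "coeff (jet m p) k = (if k \<le> m then coeff p k else 0)"
  by (simp add: jet_def coeff_poly_cutoff less_Suc_eq_le)

lemma jet_add: "jet m (p + q) = jet m p + jet m q"
  by (simp add: poly_eq_iff coeff_jet)

lemma jet_in_takiff: "jet m p \<in> takiff m"
  unfolding takiff_def by (simp add: degree_le coeff_jet)

lemma jet_takiff: "p \<in> takiff m \<Longrightarrow> jet m p = p"
  by (simp add: takiff_def poly_eq_iff coeff_jet coeff_eq_0)

lemma jet_eq_iff: "jet m p = jet m q \<longleftrightarrow> (\<forall>k\<le>m. coeff p k = coeff q k)"
  by (auto simp: poly_eq_iff coeff_jet)

context vector_space
begin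

lemma coeff_poly_scale: "coeff (poly_scale scale c p) k = scale c (coeff p k)"
  by (simp add: poly_scale_def coeff_map_poly)

lemma vector_space_poly_scale: "vector_space (poly_scale scale)"
  by unfold_locales
    (simp_all add: poly_eq_iff coeff_poly_scale scale_right_distrib scale_left_distrib)

lemma jet_scale: "jet m (poly_scale scale c p) = poly_scale scale c (jet m p)"
  by (simp add: poly_eq_iff coeff_jet coeff_poly_scale)

end

context
  fixes scale :: "complex \<Rightarrow> 'a::ab_group_add \<Rightarrow> 'a" and br :: "'a \<Rightarrow> 'a \<Rightarrow> 'a"
  assumes lie: "lie_algebra scale UNIV br"
begin

interpretation lie_algebra scale UNIV br by (fact lie)

interpretation P: vector_space "poly_scale scale" by (fact vector_space_poly_scale)

lemma br_simps:
  "br (x + y) z = br x z + br y z" "br z (x + y) = br z x + br z y"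
  "br (scale c x) z = scale c (br x z)" "br z (scale c x) = scale c (br z x)"
  using br_linear_left[of z] br_linear_right[of z] by (auto simp: linear_on_def)

lemma br_zero: "br 0 z = 0" "br z 0 = 0"
  using br_simps(1)[of 0 0 z] br_simps(2)[of z 0 0] by auto

lemma br_sum:
  "br (sum f A) z = (\<Sum>a\<in>A. br (f a) z)" "br z (sum f A) = (\<Sum>a\<in>A. br z (f a))"
  by (induction A rule: infinite_finite_induct) (auto simp: br_zero br_simps)

lemma br_swap: "br x y = - br y x"
proof -
  have "br (x + y) (x + y) = 0" "br x x = 0" "br y y = 0" by (auto intro: br_self)
  then have "br x y + br y x = 0" by (simp add: br_simps add.commute)
  then show ?thesis by (simp add: eq_neg_iff_add_eq_0)
qed

lemma coeff_poly_bracket: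
  "coeff (poly_bracket br p q) k = (\<Sum>i\<le>k. br (coeff p i) (coeff q (k - i)))"
proof -
  have "coeff (poly_bracket br p q) k =
      (\<Sum>i\<le>degree p. \<Sum>j\<le>degree q. if i + j = k then br (coeff p i) (coeff q j) else 0)"
    by (simp add: poly_bracket_def coeff_sum)
  also have "\<dots> = (\<Sum>i\<le>degree p. if i \<le> k then br (coeff p i) (coeff q (k - i)) else 0)"
  proof (rule sum.cong[OF refl])
    fix i
    have "(\<Sum>j\<le>degree q. if i + j = k then br (coeff p i) (coeff q j) else 0) =
        (\<Sum>j\<le>degree q. if j = k - i then (if i \<le> k then br (coeff p i) (coeff q j) else 0) else 0)"
      by (intro sum.cong) auto
    also have "\<dots> = (if i \<le> k then br (coeff p i) (coeff q (k - i)) else 0)"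
      by (auto simp: sum.delta br_zero coeff_eq_0)
    finally show "(\<Sum>j\<le>degree q. if i + j = k then br (coeff p i) (coeff q j) else 0) =
        (if i \<le> k then br (coeff p i) (coeff q (k - i)) else 0)" .
  qed
  also have "\<dots> = (\<Sum>i\<in>{..degree p} \<inter> {..k}. br (coeff p i) (coeff q (k - i)))"
    by (subst sum.inter_restrict) simp_all
  also have "\<dots> = (\<Sum>i\<le>k. br (coeff p i) (coeff q (k - i)))"
    by (rule sum.mono_neutral_left) (auto, metis br_zero(1) coeff_eq_0 not_le)
  finally show ?thesis .
qed

lemma poly_bracket_self: "poly_bracket br p p = 0"
proof (rule poly_eqI)
  fix k
  define g where "g i = br (coeff p i) (coeff p (k - i))" for i
  have rev: "(\<Sum>i\<in>{i. i \<le> k \<and> k < 2 * i}. g i) = (\<Sum>i\<in>{i. i \<le> k \<and> 2 * i < k}. - g i)"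
    by (rule sum.reindex_bij_witness[of _ "\<lambda>i. k - i" "\<lambda>i. k - i"])
      (auto simp: g_def br_swap[symmetric])
  have mid: "(\<Sum>i\<in>{i. i \<le> k \<and> 2 * i = k}. g i) = 0"
  proof (rule sum.neutral, rule ballI)
    fix i assume "i \<in> {i. i \<le> k \<and> 2 * i = k}"
    then have "k - i = i" by auto
    then show "g i = 0" by (simp add: g_def br_self)
  qed
  have split: "{..k} = {i. i \<le> k \<and> 2 * i < k} \<union> ({i. i \<le> k \<and> 2 * i = k} \<union> {i. i \<le> k \<and> k < 2 * i})"
    by auto
  have fin: "finite {i. i \<le> k \<and> P i}" for P by (rule finite_subset[of _ "{..k}"]) auto
  have "sum g {..k} = sum g {i. i \<le> k \<and> 2 * i < k} +
      (sum g {i. i \<le> k \<and> 2 * i = k} + sum g {i. i \<le> k \<and> k < 2 * i})"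
    unfolding split
    apply (subst sum.union_disjoint)
       apply (simp_all add: fin)
     apply (blast dest: less_not_refl2 less_asym)
    apply (rule sum.union_disjoint)
      apply (auto simp: fin)
    done
  then have "sum g {..k} = 0" by (simp add: rev mid sum_negf)
  then show "coeff (poly_bracket br p p) k = coeff 0 k" by (simp add: coeff_poly_bracket g_def)
qed

lemma coeff_triple_bracket:
  "coeff (poly_bracket br p (poly_bracket br q r)) k =
    (\<Sum>(a, b, c)\<in>{(a, b, c). a + b + c = k}. br (coeff p a) (br (coeff q b) (coeff r c)))"
proof -
  have "coeff (poly_bracket br p (poly_bracket br q r)) k =
      (\<Sum>(a, b)\<in>(SIGMA a:{..k}. {..k - a}). br (coeff p a) (br (coeff q b) (coeff r (k - a - b))))"
    by (simp add: coeff_poly_bracket br_sum sum.Sigma)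
  also have "\<dots> = (\<Sum>(a, b, c)\<in>{(a, b, c). a + b + c = k}. br (coeff p a) (br (coeff q b) (coeff r c)))"
    by (rule sum.reindex_bij_witness[of _ "\<lambda>(a, b, c). (a, b)" "\<lambda>(a, b). (a, b, k - a - b)"]) auto
  finally show ?thesis .
qed

lemma poly_jacobi:
  "poly_bracket br p (poly_bracket br q r) + poly_bracket br q (poly_bracket br r p)
    + poly_bracket br r (poly_bracket br p q) = 0"
proof (rule poly_eqI)
  fix k
  let ?T = "{(a, b, c). a + b + c = (k::nat)}"
  have 1: "coeff (poly_bracket br q (poly_bracket br r p)) k =
      (\<Sum>(a, b, c)\<in>?T. br (coeff q b) (br (coeff r c) (coeff p a)))"
    unfolding coeff_triple_bracket
    by (rule sum.reindex_bij_witness[of _ "\<lambda>(a, b, c). (b, c, a)" "\<lambda>(a, b, c). (c, a, b)"]) auto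
  have 2: "coeff (poly_bracket br r (poly_bracket br p q)) k =
      (\<Sum>(a, b, c)\<in>?T. br (coeff r c) (br (coeff p a) (coeff q b)))"
    unfolding coeff_triple_bracket
    by (rule sum.reindex_bij_witness[of _ "\<lambda>(a, b, c). (c, a, b)" "\<lambda>(a, b, c). (b, c, a)"]) auto
  show "coeff (poly_bracket br p (poly_bracket br q r) + poly_bracket br q (poly_bracket br r p)
    + poly_bracket br r (poly_bracket br p q)) k = coeff 0 k"
    unfolding coeff_add 1 2 unfolding coeff_triple_bracket
    by (auto simp: sum.distrib[symmetric] jacobi intro!: sum.neutral)
qed

lemma poly_bracket_linear:
  "poly_bracket br (p + q) r = poly_bracket br p r + poly_bracket br q r"
  "poly_bracket br r (p + q) = poly_bracket br r p + poly_bracket br r q"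
  "poly_bracket br (poly_scale scale c p) r = poly_scale scale c (poly_bracket br p r)"
  "poly_bracket br r (poly_scale scale c p) = poly_scale scale c (poly_bracket br r p)"
  by (simp_all add: poly_eq_iff coeff_poly_bracket br_simps sum.distrib coeff_poly_scale scale_sum_right)

lemma lie_algebra_poly: "lie_algebra (poly_scale scale) UNIV (poly_bracket br)"
  by unfold_locales
    (simp_all add: linear_on_def poly_bracket_linear poly_bracket_self poly_jacobi)

lemma jet_bracket: "takiff_bracket br m (jet m p) (jet m q) = jet m (poly_bracket br p q)"
  by (auto simp: takiff_bracket_def poly_eq_iff coeff_jet coeff_poly_bracket intro!: sum.cong)

lemma jet_bracket':
  "jet m (poly_bracket br p (jet m q)) = jet m (poly_bracket br p q)"
  "jet m (poly_bracket br (jet m p) q) = jet m (poly_bracket br p q)"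
  by (auto simp: poly_eq_iff coeff_jet coeff_poly_bracket intro!: sum.cong)

lemma lie_algebra_takiff: "lie_algebra (poly_scale scale) (takiff m) (takiff_bracket br m)"
proof unfold_locales
  have "coeff p k = 0" if "degree p \<le> m" "m < k" for p :: "'a poly" and k
    using that by (simp add: coeff_eq_0)
  then show "P.subspace (takiff m)"
    by (auto simp: P.subspace_def takiff_def coeff_poly_scale intro!: degree_le)
  fix x y z :: "'a poly"
  show "takiff_bracket br m x y \<in> takiff m"
    by (simp add: takiff_bracket_def jet_in_takiff)
  show "linear_on (poly_scale scale) (poly_scale scale) (takiff m) (takiff_bracket br m x)"
    "linear_on (poly_scale scale) (poly_scale scale) (takiff m) (\<lambda>x. takiff_bracket br m x y)"
    by (simp_all add: linear_on_def takiff_bracket_def poly_bracket_linear jet_add jet_scale)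
  show "takiff_bracket br m x x = 0"
    by (simp add: takiff_bracket_def poly_bracket_self jet_def)
  show "takiff_bracket br m x (takiff_bracket br m y z) + takiff_bracket br m y (takiff_bracket br m z x)
      + takiff_bracket br m z (takiff_bracket br m x y) = 0"
    by (simp add: takiff_bracket_def jet_bracket' jet_add[symmetric] poly_jacobi)
      (simp add: jet_def)
qed

lemma takiff_quotient:
  "lie_algebra (poly_scale scale) UNIV (poly_bracket br)"
  "lie_algebra (poly_scale scale) (takiff m) (takiff_bracket br m)"
  "linear_on (poly_scale scale) (poly_scale scale) UNIV (jet m)"
  "jet m (poly_bracket br p q) = takiff_bracket br m (jet m p) (jet m q)"
  "range (jet m) = takiff m"
  "jet m p = 0 \<longleftrightarrow> (\<forall>k\<le>m. coeff p k = 0)"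
proof -
  show "range (jet m) = takiff m"
    using jet_in_takiff jet_takiff by (metis image_subset_iff rangeI subsetI subset_antisym)
  show "jet m p = 0 \<longleftrightarrow> (\<forall>k\<le>m. coeff p k = 0)"
    by (auto simp: poly_eq_iff coeff_jet)
qed (simp_all add: lie_algebra_poly lie_algebra_takiff jet_bracket linear_on_def jet_add jet_scale)

end

end

theory Submission
  imports Defs
begin

text \<open>
  For a polynomial \<open>z\<close> over \<open>\<gg>\<close> let \<open>d\<^sub>N\<close> be the dimension of the centralizer of \<open>z(N)\<close> in
  \<open>\<gg>\<^sub>N\<close>, and let \<open>I\<^sub>N \<subseteq> \<gg>\<close> be the space of the constant terms of the elements of this centralizer.
  The elements with constant term \<open>0\<close> are exactly the multiples by \<open>T\<close> of the
  centralizer of \<open>z(N - 1)\<close>, so \<open>d\<^sub>N = d\<^sub>N\<^sub>-\<^sub>1 + dim I\<^sub>N\<close> (\<open>dim_commutant_Suc\<close>). Truncation shows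
  \<open>I\<^sub>N\<^sub>+\<^sub>1 \<subseteq> I\<^sub>N\<close> (\<open>constant_terms_antimono\<close>); thus the increments of \<open>d\<close> never grow.

  Moreover no increment is smaller than the index \<open>\<chi>\<close> (\<open>dim_constant_terms_ge\<close>). Indeed, an invariant
  non-degenerate form identifies the stabilizer of the linear form \<open>K w\<close> with the centralizer of \<open>w\<close>,
  so every \<open>ad w\<close> has rank at most \<open>dim \<gg> - \<chi>\<close>. A polynomial \<open>[u, z]\<close> with \<open>deg u \<le> N\<close> has
  degree at most \<open>N + deg z\<close> and is determined by its values at \<open>N + deg z + 1\<close> points; the value at
  \<open>t\<close> is in the image of \<open>ad z(t)\<close>. Hence these brackets span at most
  \<open>(N + deg z + 1) (dim \<gg> - \<chi>)\<close> dimensions, and rank-nullity leaves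
  \<open>d\<^sub>N \<ge> (N + 1) \<chi> - deg z (dim \<gg> - \<chi>)\<close>. If one increment were less than \<open>\<chi>\<close>, all later ones would
  be too, contradicting this growth.

  The hypothesis \<open>d\<^sub>n = d\<^sub>m + (n - m) \<chi>\<close> for \<open>y\<close> forces the increment at \<open>m + 1\<close> to be \<open>\<chi>\<close>, and then
  all increments beyond \<open>m\<close> equal \<open>\<chi>\<close>, being squeezed from both sides. So \<open>y\<close>
  itself attains the minimum in the modality for every \<open>n' \<ge> m' \<ge> m\<close>.
\<close>

section \<open>Rank and nullity on finite-dimensional subspaces\<close>

text \<open>
  The polynomials over a nonzero \<open>\<gg>\<close> form an infinite-dimensional space, where the dimension of a
  subspace counts basis elements only if a finite set \<open>T\<close> spans it (the cardinality of an infinite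
  basis is \<open>0\<close>).
\<close>

lemma (in vector_space) dim_mono_in_finite_span:
  assumes "A \<subseteq> B" "B \<subseteq> span T" "finite T"
  shows "dim A \<le> dim B"
proof -
  obtain C where C: "C \<subseteq> A" "independent C" "A \<subseteq> span C" "card C = dim A"
    using basis_exists by blast
  obtain D where D: "D \<subseteq> B" "independent D" "B \<subseteq> span D" "card D = dim B"
    using basis_exists by blast
  have "D \<subseteq> span T" "C \<subseteq> span D" using assms C D by auto
  then have "finite D" "card C \<le> card D"
    using independent_span_bound D(2) C(2) assms(3) by blast+
  then show ?thesis using C D by simp
qed

lemma (in vector_space) dim_zero_subspace: "dim {0} = 0"
  using dim_le_card[of "{0}" "{}"] by simp

lemma (in vector_space) independent_span_Diff_disjoint:
  assumes "independent C" "B \<subseteq> C" "x \<in> span B" "x \<in> span (C - B)"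
  shows "x = 0"
proof -
  have "representation C x = representation B x"
    "representation C x = representation (C - B) x"
    using assms by (auto intro!: representation_extend)
  then have "representation C x b = 0" for b
    by (metis representation_ne_zero Diff_iff)
  moreover have "x \<in> span C" using assms span_mono by blast
  ultimately show ?thesis
    using sum_nonzero_representation_eq[OF assms(1), of x] by simp
qed

text \<open>
  A basis \<open>B\<close> of the kernel extends to a basis \<open>C\<close> of \<open>S\<close>, and \<open>f\<close> maps \<open>C - B\<close>
  bijectively to a basis of the image.
\<close>

lemma (in vector_space_pair) dim_eq_dim_kernel_plus_dim_image:
  assumes lin: "Vector_Spaces.linear s1 s2 f" and S: "vs1.subspace S"
    and T: "S \<subseteq> vs1.span T" "finite T"
  shows "vs1.dim S = vs1.dim {x \<in> S. f x = 0} + vs2.dim (f ` S)"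
proof -
  interpret f: Vector_Spaces.linear s1 s2 f by (fact lin)
  let ?K = "{x \<in> S. f x = 0}"
  obtain B where B: "B \<subseteq> ?K" "vs1.independent B" "?K \<subseteq> vs1.span B"
    using vs1.maximal_independent_subset by blast
  have "B \<subseteq> S" using B by auto
  then obtain C where C: "B \<subseteq> C" "C \<subseteq> S" "vs1.independent C" "S \<subseteq> vs1.span C"
    using vs1.maximal_independent_subset_extend[OF _ B(2)] by blast
  have finC: "finite C" using vs1.independent_span_bound[OF T(2) C(3)] C(2) T(1) by blast
  have inj: "inj_on f (vs1.span (C - B))"
  proof (subst f.inj_on_iff_eq_0)
    show "vs1.subspace (vs1.span (C - B))" by simp
    show "\<forall>x\<in>vs1.span (C - B). f x = 0 \<longrightarrow> x = 0"
    proof (intro ballI impI)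
      fix x assume x: "x \<in> vs1.span (C - B)" "f x = 0"
      have "vs1.span (C - B) \<subseteq> S" using C S by (intro vs1.span_minimal) auto
      then have "x \<in> vs1.span B" using x B by auto
      then show "x = 0"
        using vs1.independent_span_Diff_disjoint[OF C(3) C(1)] x by blast
    qed
  qed
  have "vs1.independent (C - B)" using C vs1.independent_mono by blast
  then have ind: "vs2.independent (f ` (C - B))"
    using linear_independent_injective_image[OF lin _ inj] by blast
  have "f x \<in> vs2.span (f ` (C - B))" if "x \<in> S" for x
  proof -
    have "f ` C \<subseteq> insert 0 (f ` (C - B))" using B by auto
    then have "vs2.span (f ` C) \<subseteq> vs2.span (f ` (C - B))"
      by (metis vs2.span_insert_0 vs2.span_mono)
    moreover have "f x \<in> vs2.span (f ` C)" using that C by (auto simp: linear_span_image[OF lin])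
    ultimately show ?thesis by blast
  qed
  then have "vs2.dim (f ` S) = card (f ` (C - B))"
    using ind C by (intro vs2.basis_card_eq_dim[symmetric]) auto
  also have "\<dots> = card (C - B)"
    using inj by (intro card_image) (meson inj_on_subset vs1.span_superset)
  finally have "vs2.dim (f ` S) = card C - card B"
    using C finC by (simp add: card_Diff_subset finite_subset)
  moreover have "vs1.dim S = card C" using C by (intro vs1.basis_card_eq_dim[symmetric]) auto
  moreover have "vs1.dim ?K = card B" using B by (intro vs1.basis_card_eq_dim[symmetric]) auto
  moreover have "card B \<le> card C" using C finC by (simp add: card_mono)
  ultimately show ?thesis by simp
qed

section \<open>Evaluation of vector-valued polynomials\<close>

definition (in vector_space) eval_poly :: "'a \<Rightarrow> 'b poly \<Rightarrow> 'b"
  where "eval_poly t p = (\<Sum>i\<le>degree p. scale (t ^ i) (coeff p i))"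

context vector_space
begin

lemma eval_poly_eq:
  assumes "degree p \<le> M"
  shows "eval_poly t p = (\<Sum>i\<le>M. scale (t ^ i) (coeff p i))"
  unfolding eval_poly_def using assms
  by (intro sum.mono_neutral_left) (auto simp: coeff_eq_0)

lemma eval_poly_add: "eval_poly t (p + q) = eval_poly t p + eval_poly t q"
proof -
  let ?M = "max (degree p) (degree q)"
  have "degree (p + q) \<le> ?M" by (rule degree_add_le) auto
  then show ?thesis
    by (simp add: eval_poly_eq[of _ ?M] scale_right_distrib sum.distrib)
qed

lemma eval_poly_scale: "eval_poly t (poly_scale scale c p) = scale c (eval_poly t p)"
proof -
  have "degree (poly_scale scale c p) \<le> degree p"
    by (auto simp: coeff_poly_scale coeff_eq_0 intro: degree_le)
  then show ?thesis
    by (simp add: eval_poly_eq[of _ "degree p"] coeff_poly_scale scale_sum_right mult.commute)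
qed

lemma linear_eval_poly: "Vector_Spaces.linear (poly_scale scale) scale (eval_poly t)"
  by (simp add: Vector_Spaces.linear_iff vector_space_poly_scale vector_space_axioms
      eval_poly_add eval_poly_scale)

lemma linear_coeff: "Vector_Spaces.linear (poly_scale scale) scale (\<lambda>p. coeff p k)"
  by (simp add: Vector_Spaces.linear_iff vector_space_poly_scale vector_space_axioms coeff_poly_scale)

lemma eval_poly_sum: "eval_poly t (sum f A) = (\<Sum>a\<in>A. eval_poly t (f a))"
  by (induction A rule: infinite_finite_induct) (auto simp: eval_poly_add eval_poly_def[of t 0])

lemma eval_poly_monom: "eval_poly t (monom v k) = scale (t ^ k) v"
proof -
  have "(\<Sum>i\<le>k. scale (t ^ i) (coeff (monom v k) i)) = (\<Sum>i\<le>k. if i = k then scale (t ^ k) v else 0)"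
    by (intro sum.cong) auto
  then show ?thesis
    by (simp add: eval_poly_eq[of _ k] degree_monom_le)
qed

end

text \<open>
  Each coordinate of \<open>p\<close> with respect to the basis is a complex polynomial of degree at most \<open>M\<close> with
  \<open>M + 1\<close> roots.
\<close>

lemma (in finite_dimensional_vector_space) eval_poly_many_zeros:
  assumes "degree p \<le> M" and inj: "inj_on t {..M}" and zero: "\<And>i. i \<le> M \<Longrightarrow> eval_poly (t i) p = 0"
  shows "p = 0"
proof -
  have lin: "Vector_Spaces.linear scale (*) (\<lambda>v. representation Basis v b)" for b
    by (intro linear_representation independent_Basis span_Basis)
  have rep: "representation Basis v b = 0"
    if "v = coeff p k" "k \<le> M" for v b k
  proof -
    interpret r: Vector_Spaces.linear scale "(*)" "\<lambda>v. representation Basis v b" by (rule lin)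
    define q where "q = (\<Sum>i\<le>M. monom (representation Basis (coeff p i) b) i)"
    have coeff: "coeff q k = representation Basis (coeff p k) b" if "k \<le> M" for k
      using that by (simp add: q_def coeff_sum)
    have deg: "degree q \<le> M" unfolding q_def
      by (intro degree_sum_le) (auto intro: order.trans[OF degree_monom_le])
    have "poly q (t i) = 0" if "i \<le> M" for i
    proof -
      have "poly q (t i) = representation Basis (eval_poly (t i) p) b"
        by (simp add: q_def poly_sum poly_monom eval_poly_eq[OF assms(1)] r.sum r.scale mult.commute)
      then show ?thesis using zero[OF that] r.zero by simp
    qed
    then have sub: "t ` {..M} \<subseteq> {x. poly q x = 0}" by auto
    have "q = 0"
    proof (rule ccontr)
      assume "q \<noteq> 0"
      then have "card (t ` {..M}) \<le> card {x. poly q x = 0}"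
        by (intro card_mono sub poly_roots_finite)
      also have "\<dots> \<le> M" using card_poly_roots_bound[OF \<open>q \<noteq> 0\<close>] deg by simp
      finally show False by (simp add: card_image[OF inj])
    qed
    then show ?thesis using coeff that by simp
  qed
  have "coeff p k = 0" for k
  proof (cases "k \<le> M")
    case True
    then show ?thesis
      using sum_nonzero_representation_eq[OF independent_Basis, of "coeff p k"] rep span_Basis by auto
  next
    case False
    then show ?thesis using assms(1) by (simp add: coeff_eq_0)
  qed
  then show ?thesis by (simp add: poly_eq_iff)
qed

section \<open>Truncated commutants\<close>

locale finite_dimensional_lie_algebra =
  finite_dimensional_vector_space scale Basis + lie_algebra scale UNIV br
  for scale :: "complex \<Rightarrow> 'a::ab_group_add \<Rightarrow> 'a" and Basis :: "'a set"
    and br :: "'a \<Rightarrow> 'a \<Rightarrow> 'a"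
begin

sublocale P: vector_space "poly_scale scale"
  by (rule vector_space_poly_scale)

sublocale PV: vector_space_pair "poly_scale scale" scale
  by unfold_locales

sublocale PP: vector_space_pair "poly_scale scale" "poly_scale scale"
  by unfold_locales

sublocale VV: vector_space_pair scale scale
  by unfold_locales

lemma lie: "lie_algebra scale UNIV br"
  by unfold_locales

lemma eval_poly_bracket: "eval_poly t (poly_bracket br p q) = br (eval_poly t p) (eval_poly t q)"
proof -
  have "eval_poly t (poly_bracket br p q) =
    (\<Sum>i\<le>degree p. \<Sum>j\<le>degree q. scale (t ^ (i + j)) (br (coeff p i) (coeff q j)))"
    by (simp add: poly_bracket_def eval_poly_sum eval_poly_monom)
  also have "\<dots> = br (eval_poly t p) (eval_poly t q)"
    unfolding eval_poly_def br_sum[OF lie] br_simps[OF lie]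
    by (subst sum.swap) (simp add: power_add mult.commute scale_sum_right)
  finally show ?thesis .
qed

lemma linear_bracket: "Vector_Spaces.linear scale scale (\<lambda>v. br v w)"
  by (simp add: Vector_Spaces.linear_iff vector_space_axioms br_simps[OF lie])

lemma linear_poly_bracket:
  "Vector_Spaces.linear (poly_scale scale) (poly_scale scale) (\<lambda>p. poly_bracket br p z)"
  by (simp add: Vector_Spaces.linear_iff P.vector_space_axioms poly_bracket_linear[OF lie])

lemma poly_bracket_pCons: "poly_bracket br (pCons 0 u) z = pCons 0 (poly_bracket br u z)"
proof (rule poly_eqI)
  fix k
  show "coeff (poly_bracket br (pCons 0 u) z) k = coeff (pCons 0 (poly_bracket br u z)) k"
  proof (cases k)
    case (Suc l)
    then show ?thesis
      by (simp add: coeff_poly_bracket[OF lie] br_zero[OF lie] sum.atMost_Suc_shift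
          del: sum.atMost_Suc)
  qed (simp add: coeff_poly_bracket[OF lie] br_zero[OF lie])
qed

text \<open>
  The centralizer of the image of \<open>z\<close> in the \<open>N\<close>-th Takiff algebra, written with the polynomial
  bracket so that no truncation interferes when \<open>N\<close> varies.
\<close>

definition commutant :: "nat \<Rightarrow> 'a poly \<Rightarrow> 'a poly set"
  where "commutant N z = {u. degree u \<le> N \<and> (\<forall>k\<le>N. coeff (poly_bracket br u z) k = 0)}"

definition constant_terms :: "nat \<Rightarrow> 'a poly \<Rightarrow> 'a set"
  where "constant_terms N z = (\<lambda>u. coeff u 0) ` commutant N z"

lemma takiff_centralizer_dim_eq: "takiff_centralizer_dim scale br N z = P.dim (commutant N z)"
proof -
  have "centralizer (takiff N) (takiff_bracket br N) (jet N z) = commutant N z"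
    unfolding centralizer_def takiff_bracket_def jet_bracket'(1)[OF lie] commutant_def takiff_def
    by (simp add: takiff_quotient(6)[OF lie])
  then show ?thesis by (simp add: takiff_centralizer_dim_def)
qed

lemma subspace_takiff: "P.subspace (takiff N)"
  using lie_algebra_takiff[OF lie] by (rule lie_algebra.subspace_carrier)

lemma subspace_commutant: "P.subspace (commutant N z)"
  using subspace_takiff[of N]
  by (auto simp: P.subspace_def commutant_def takiff_def poly_bracket_linear[OF lie] coeff_poly_scale)
    (simp add: coeff_poly_bracket[OF lie] br_zero[OF lie])

lemma takiff_subset_finite_span:
  obtains T where "finite T" "takiff N \<subseteq> P.span T"
proof
  let ?T = "(\<lambda>(b, k). monom b k) ` (Basis \<times> {..N})"
  show "finite ?T" using finite_Basis by simp
  have *: "monom v k \<in> P.span ?T" if "k \<le> N" for v k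
  proof -
    have "v \<in> span Basis" by (simp add: span_Basis)
    then show ?thesis
    proof (induction rule: span_induct_alt)
      case base
      then show ?case by (simp add: P.span_zero)
    next
      case (step c b y)
      have "monom (scale c b + y) k = poly_scale scale c (monom b k) + monom y k"
        by (simp add: poly_eq_iff coeff_poly_scale)
      moreover have "monom b k \<in> ?T" using step that by force
      ultimately show ?case using step P.span_add P.span_scale P.span_base by metis
    qed
  qed
  show "takiff N \<subseteq> P.span ?T"
  proof
    fix p :: "'a poly" assume "p \<in> takiff N"
    then have "p = (\<Sum>i\<le>N. monom (coeff p i) i)"
      by (simp add: takiff_def poly_as_sum_of_monoms')
    then show "p \<in> P.span ?T" using * by (metis (no_types, lifting) P.span_sum atMost_iff)
  qed
qed

lemma commutant_subset_takiff: "commutant N z \<subseteq> takiff N"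
  by (auto simp: commutant_def takiff_def)

text \<open>
  Since \<open>[T w, z] = T [w, z]\<close>, the polynomial \<open>T w\<close> commutes with \<open>z\<close> up to order \<open>N + 1\<close> if and only if
  \<open>w\<close> does so up to order \<open>N\<close>.
\<close>

lemma commutant_Suc_kernel:
  "{u \<in> commutant (Suc N) z. coeff u 0 = 0} = pCons 0 ` commutant N z"
proof (intro set_eqI iffI)
  fix u assume u: "u \<in> {u \<in> commutant (Suc N) z. coeff u 0 = 0}"
  obtain a w where w: "u = pCons a w" by (cases u)
  then have uw: "u = pCons 0 w" using u by simp
  have "degree w \<le> N"
    using u uw by (cases "w = 0") (auto simp: commutant_def)
  moreover have "coeff (poly_bracket br w z) k = 0" if "k \<le> N" for k
  proof -
    have "coeff (poly_bracket br u z) (Suc k) = 0" using u that by (simp add: commutant_def)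
    then show ?thesis by (simp add: uw poly_bracket_pCons)
  qed
  ultimately show "u \<in> pCons 0 ` commutant N z" using uw by (auto simp: commutant_def)
next
  fix u assume "u \<in> pCons 0 ` commutant N z"
  then show "u \<in> {u \<in> commutant (Suc N) z. coeff u 0 = 0}"
    by (auto simp: commutant_def poly_bracket_pCons coeff_pCons degree_pCons_eq_if split: nat.splits)
qed

lemma dim_commutant_kernel:
  "P.dim (commutant N z) = P.dim {u \<in> commutant N z. coeff u 0 = 0} + dim (constant_terms N z)"
proof -
  obtain T where T: "finite T" "takiff N \<subseteq> P.span T" using takiff_subset_finite_span by blast
  show ?thesis unfolding constant_terms_def
    by (rule PV.dim_eq_dim_kernel_plus_dim_image[OF linear_coeff subspace_commutant])
      (use T commutant_subset_takiff in blast)+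
qed

lemma dim_commutant_0: "P.dim (commutant 0 z) = dim (constant_terms 0 z)"
proof -
  have "{u \<in> commutant 0 z. coeff u 0 = 0} = {0}"
  proof -
    have "u = 0" if "u \<in> commutant 0 z" "coeff u 0 = 0" for u
      using that by (metis (mono_tags, lifting) commutant_def le_zero_eq leading_coeff_0_iff mem_Collect_eq)
    then show ?thesis using P.subspace_0[OF subspace_commutant] by auto
  qed
  then show ?thesis using dim_commutant_kernel[of 0 z] by (simp add: P.dim_zero_subspace)
qed

lemma dim_commutant_Suc:
  "P.dim (commutant (Suc N) z) = P.dim (commutant N z) + dim (constant_terms (Suc N) z)"
proof -
  obtain T where T: "finite T" "takiff N \<subseteq> P.span T" using takiff_subset_finite_span by blast
  have lin: "Vector_Spaces.linear (poly_scale scale) (poly_scale scale) (pCons 0)"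
    by (auto simp: Vector_Spaces.linear_iff P.vector_space_axioms poly_eq_iff coeff_poly_scale
        coeff_pCons split: nat.splits)
  have "{u \<in> commutant N z. pCons 0 u = 0} = {0}"
    using P.subspace_0[OF subspace_commutant] by auto
  then have "P.dim (commutant N z) = P.dim (pCons 0 ` commutant N z)"
    using PP.dim_eq_dim_kernel_plus_dim_image[OF lin subspace_commutant[of N z], of T]
      T commutant_subset_takiff[of N z] by (auto simp: P.dim_zero_subspace)
  then show ?thesis using dim_commutant_kernel[of "Suc N" z] by (simp add: commutant_Suc_kernel)
qed

text \<open>A witness \<open>u\<close> at level \<open>N\<close> truncates to a witness at level \<open>M\<close> with the same constant term.\<close>

lemma constant_terms_antimono:
  assumes "M \<le> N"
  shows "constant_terms N z \<subseteq> constant_terms M z"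
proof
  fix v assume "v \<in> constant_terms N z"
  then obtain u where u: "u \<in> commutant N z" "v = coeff u 0" by (auto simp: constant_terms_def)
  have "\<forall>k\<le>M. coeff (poly_bracket br (jet M u) z) k = coeff (poly_bracket br u z) k"
    using jet_bracket'(2)[OF lie, of M u z] by (simp add: jet_eq_iff)
  then have "jet M u \<in> commutant M z"
    using u assms jet_in_takiff[of M u] by (auto simp: commutant_def takiff_def)
  then show "v \<in> constant_terms M z"
    using u unfolding constant_terms_def by (intro image_eqI[of _ _ "jet M u"]) (simp_all add: coeff_jet)
qed

lemma dim_constant_terms_antimono: "M \<le> N \<Longrightarrow> dim (constant_terms N z) \<le> dim (constant_terms M z)"
  by (intro dim_subset constant_terms_antimono)

text \<open>The whole Takiff algebra is the centralizer of \<open>0\<close>, where every increment is \<open>dim \<gg>\<close>.\<close>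

lemma dim_takiff: "P.dim (takiff N :: 'a poly set) = Suc N * dimension"
proof -
  have br0: "poly_bracket br u 0 = 0" for u
    by (simp add: poly_eq_iff coeff_poly_bracket[OF lie] br_zero[OF lie])
  have com: "commutant N 0 = takiff N" for N by (simp add: commutant_def takiff_def br0)
  have "v \<in> constant_terms N 0" for v N
    unfolding constant_terms_def com by (rule image_eqI[of _ _ "[:v:]"]) (auto simp: takiff_def)
  then have lead: "constant_terms N 0 = UNIV" for N by blast
  have "P.dim (commutant N 0) = Suc N * dimension"
    by (induction N) (simp_all add: dim_commutant_0 dim_commutant_Suc lead dimension_def)
  then show ?thesis by (simp add: com)
qed

section \<open>Growth of the commutants\<close>

text \<open>
  Vanishing at one more point costs at most \<open>r\<close> dimensions, and vanishing at the \<open>M + 1\<close>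
  points \<open>0, \<dots>, M\<close> leaves only \<open>0\<close>. The argument replaces the usual passage to ranks over the
  field of rational functions.
\<close>

lemma dim_le_of_evaluations:
  assumes S: "P.subspace S" "S \<subseteq> takiff M" and r: "\<And>t. dim (eval_poly t ` S) \<le> r"
  shows "P.dim S \<le> Suc M * r"
proof -
  obtain T where T: "finite T" "takiff M \<subseteq> P.span T" using takiff_subset_finite_span by blast
  define Z where "Z j = {s \<in> S. \<forall>i<j. eval_poly (of_nat i) s = 0}" for j
  have "P.dim S \<le> P.dim (Z j) + j * r" for j
  proof (induction j)
    case 0
    then show ?case by (simp add: Z_def)
  next
    case (Suc j)
    have ev0: "eval_poly t 0 = 0" for t by (simp add: eval_poly_def)
    have sub: "P.subspace (Z j)"
      using S(1) by (auto simp: P.subspace_def Z_def eval_poly_add eval_poly_scale ev0)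
    have "P.dim (Z j) = P.dim {s \<in> Z j. eval_poly (of_nat j) s = 0} + dim (eval_poly (of_nat j) ` Z j)"
      by (rule PV.dim_eq_dim_kernel_plus_dim_image[OF linear_eval_poly sub _ T(1)])
        (use S T in \<open>auto simp: Z_def\<close>)
    moreover have "{s \<in> Z j. eval_poly (of_nat j) s = 0} = Z (Suc j)"
      by (auto simp: Z_def less_Suc_eq)
    moreover have "dim (eval_poly (of_nat j) ` Z j) \<le> r"
      by (rule order.trans[OF dim_subset r]) (auto simp: Z_def)
    ultimately show ?case using Suc by simp
  qed
  moreover have "Z (Suc M) \<subseteq> {0}"
  proof
    fix s assume s: "s \<in> Z (Suc M)"
    have "s = 0"
    proof (rule eval_poly_many_zeros)
      show "degree s \<le> M" using s S by (auto simp: Z_def takiff_def)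
      show "inj_on (of_nat :: nat \<Rightarrow> complex) {..M}" by (simp add: inj_on_def)
      show "eval_poly (of_nat i) s = 0" if "i \<le> M" for i using s that by (simp add: Z_def)
    qed
    then show "s \<in> {0}" by simp
  qed
  then have "P.dim (Z (Suc M)) = 0"
    using P.dim_mono_in_finite_span[of "Z (Suc M)" "{0}" "{0}"]
    by (simp add: P.dim_zero_subspace P.span_base)
  ultimately show ?thesis by (metis add_0)
qed

text \<open>
  Exact solutions of \<open>[u, z] = 0\<close> of degree at most \<open>N\<close> already suffice for the bound: their dimension
  is controlled by rank-nullity, since every bracket takes its value at \<open>t\<close> in the image of
  \<open>ad z(t)\<close>, whose codimension is at least \<open>c\<close>. What matters is that the error term does not depend on \<open>N\<close>.
\<close>

lemma dim_commutant_growth: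
  assumes c: "\<And>w. c \<le> dim {v. br v w = 0}"
  shows "Suc N * c \<le> P.dim (commutant N z) + degree z * dimension"
proof -
  let ?f = "\<lambda>u. poly_bracket br u z" and ?e = "degree z"
  obtain T where T: "finite T" "takiff N \<subseteq> P.span T" using takiff_subset_finite_span by blast
  have image: "dim (range (\<lambda>v. br v w)) + c \<le> dimension" for w
    using VV.dim_eq_dim_kernel_plus_dim_image[OF linear_bracket subspace_UNIV, of Basis w]
      c[of w] by (simp add: finite_Basis span_Basis dimension_def)
  have deg: "degree (poly_bracket br u z) \<le> N + ?e" if "degree u \<le> N" for u
    unfolding poly_bracket_def using that
    by (intro degree_sum_le finite_atMost order.trans[OF degree_monom_le]) auto
  interpret f: Vector_Spaces.linear "poly_scale scale" "poly_scale scale" ?f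
    by (rule linear_poly_bracket)
  have "P.dim (?f ` takiff N) \<le> Suc (N + ?e) * (dimension - c)"
  proof (rule dim_le_of_evaluations)
    show "P.subspace (?f ` takiff N)" by (intro f.subspace_image subspace_takiff)
    show "?f ` takiff N \<subseteq> takiff (N + ?e)" using deg by (auto simp: takiff_def)
    show "dim (eval_poly t ` ?f ` takiff N) \<le> dimension - c" for t
    proof -
      have "eval_poly t ` ?f ` takiff N \<subseteq> range (\<lambda>v. br v (eval_poly t z))"
        by (auto simp: eval_poly_bracket)
      then show ?thesis using image[of "eval_poly t z"] dim_subset by (metis add_le_imp_le_diff le_trans)
    qed
  qed
  moreover have "P.dim {u \<in> takiff N. ?f u = 0} \<le> P.dim (commutant N z)"
    using T commutant_subset_takiff[of N z]
    by (intro P.dim_mono_in_finite_span[of _ _ T]) (auto simp: commutant_def takiff_def)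
  moreover have "P.dim (takiff N :: 'a poly set) = P.dim {u \<in> takiff N. ?f u = 0} + P.dim (?f ` takiff N)"
    by (rule PP.dim_eq_dim_kernel_plus_dim_image[OF linear_poly_bracket subspace_takiff T(2,1)])
  ultimately have "Suc N * dimension \<le> P.dim (commutant N z) + Suc (N + ?e) * (dimension - c)"
    by (simp add: dim_takiff)
  moreover obtain d where d: "dimension = c + d"
    using image[of 0] by (metis add.commute le_Suc_ex le_trans le_add2)
  ultimately show ?thesis by (simp add: algebra_simps)
qed

text \<open>
  An increment below \<open>c\<close> would persist for all larger levels, so the centralizers would grow at a
  rate of at most \<open>c - 1\<close> per level, too slowly for \<open>dim_commutant_growth\<close>.
\<close>

lemma dim_constant_terms_ge:
  assumes c: "\<And>w. c \<le> dim {v. br v w = 0}"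
  shows "c \<le> dim (constant_terms k z)"
proof (rule ccontr)
  assume "\<not> c \<le> dim (constant_terms k z)"
  then have small: "dim (constant_terms (k + N) z) \<le> c - 1" and "0 < c" for N
    using dim_constant_terms_antimono[of k "k + N" z] by auto
  then obtain c' where c': "c = Suc c'" by (metis gr0_implies_Suc)
  have upper: "P.dim (commutant (k + N) z) \<le> P.dim (commutant k z) + N * c'" for N
  proof (induction N)
    case (Suc N)
    then show ?case using small[of "Suc N"] by (simp add: dim_commutant_Suc c')
  qed simp
  \<comment> \<open>\<open>N\<close> further levels produce a deficit of at least \<open>N\<close>, chosen to use up the constants of both bounds\<close>
  define N where "N = P.dim (commutant k z) + degree z * dimension"
  show False
    using dim_commutant_growth[OF c, of "k + N" z] upper[of N] N_def
    by (simp add: c' add_mult_distrib)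
qed

lemma takiff_centralizer_dim_add_le:
  assumes c: "\<And>w. c \<le> dim {v. br v w = 0}"
  shows "takiff_centralizer_dim scale br m z + j * c \<le> takiff_centralizer_dim scale br (m + j) z"
  unfolding takiff_centralizer_dim_eq
proof (induction j)
  case (Suc j)
  then show ?case using dim_constant_terms_ge[OF c, where k = "Suc (m + j)" and z = z]
    by (simp add: dim_commutant_Suc)
qed simp

end

section \<open>Index and modality\<close>

text \<open>
  Invariance gives \<open>K w [v, z] = K [w, v] z\<close>, so by non-degeneracy the
  centralizer of \<open>w\<close> is the stabilizer of the linear form \<open>K w\<close>.
\<close>

lemma (in finite_dimensional_lie_algebra) index_le_dim_centralizer:
  assumes K: "invariant_form scale UNIV br K" "nondegenerate_form UNIV K"
  shows "index scale UNIV br \<le> dim {v. br v w = 0}"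
proof -
  have "coadjoint_stabilizer UNIV br (K w) = {v. br v w = 0}"
  proof -
    have "K w (br v z) = K (br w v) z" for v z
      using K(1) unfolding invariant_form_def by (metis UNIV_I)
    moreover have "(\<forall>z. K u z = 0) \<longleftrightarrow> u = 0" for u
    proof -
      have "K 0 z = 0" for z
      proof -
        have "K (0 + 0) z = K 0 z + K 0 z"
          using K(1) unfolding invariant_form_def linear_on_def by blast
        then show ?thesis by simp
      qed
      then show ?thesis using K(2) by (auto simp: nondegenerate_form_def)
    qed
    moreover have "br w v = 0 \<longleftrightarrow> br v w = 0" for v using br_swap[OF lie, of v w] by simp
    ultimately show ?thesis by (auto simp: coadjoint_stabilizer_def)
  qed
  moreover have "linear_on scale (*) UNIV (K w)" using K(1) by (simp add: invariant_form_def)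
  ultimately show ?thesis
    unfolding index_def by (metis (mono_tags, lifting) bdd_below_bot cINF_lower mem_Collect_eq)
qed

lemma takiff_centralizer_dim_cong:
  "jet m x = jet m y \<Longrightarrow> takiff_centralizer_dim scale br m x = takiff_centralizer_dim scale br m y"
  by (simp add: takiff_centralizer_dim_def)

theorem proposition1p6:
  fixes scale :: "complex \<Rightarrow> 'a::ab_group_add \<Rightarrow> 'a"
    and Basis :: "'a set"
    and br :: "'a \<Rightarrow> 'a \<Rightarrow> 'a"
    and x :: "'a poly"
    and m n :: nat
  assumes fin_dim: "finite_dimensional_vector_space scale Basis"
    and quadratic: "quadratic_lie_algebra scale UNIV br"
    and "m < n"
  shows "\<forall>y :: 'a poly.
    jet m x = jet m y \<and>
    takiff_centralizer_dim scale br n y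
      = (n - m) * index scale UNIV br + takiff_centralizer_dim scale br m x \<longrightarrow>
    (\<forall>m' n' :: nat. m \<le> m' \<and> m' \<le> n' \<longrightarrow>
      modality scale br m' n' y = int ((n' - m') * index scale UNIV br))"
proof (intro allI impI)
  fix y :: "'a poly" and m' n' :: nat
  interpret quadratic_lie_algebra scale UNIV br by (fact quadratic)
  interpret finite_dimensional_lie_algebra scale Basis br
    by (intro finite_dimensional_lie_algebra.intro fin_dim lie_algebra_axioms)
  obtain K where K: "invariant_form scale UNIV br K" "nondegenerate_form UNIV K"
    using quadratic by blast
  let ?d = "takiff_centralizer_dim scale br" and ?\<chi> = "index scale UNIV br"
  let ?c = "\<lambda>k. dim (constant_terms k y)"
  note ge = index_le_dim_centralizer[OF K]
  assume "jet m x = jet m y \<and> ?d n y = (n - m) * ?\<chi> + ?d m x"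
  then have d: "?d n y = (n - m) * ?\<chi> + ?d m y"
    using takiff_centralizer_dim_cong[of m x y scale br] by simp
  assume mn': "m \<le> m' \<and> m' \<le> n'"
  \<comment> \<open>each of the \<open>n - m\<close> increments is at least \<open>\<chi>\<close> and they sum to \<open>(n - m) \<chi>\<close>\<close>
  have "?c (Suc m) = ?\<chi>"
  proof -
    have "?d (Suc m) y + (n - Suc m) * ?\<chi> \<le> ?d n y"
      using takiff_centralizer_dim_add_le[OF ge, of "Suc m" y "n - Suc m"] \<open>m < n\<close> by simp
    moreover have "n - m = Suc (n - Suc m)" using \<open>m < n\<close> by simp
    ultimately have "?c (Suc m) \<le> ?\<chi>"
      using d by (simp add: takiff_centralizer_dim_eq dim_commutant_Suc)
    then show ?thesis using dim_constant_terms_ge[OF ge] by (simp add: le_antisym)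
  qed
  then have c: "?c k = ?\<chi>" if "m < k" for k
    using dim_constant_terms_antimono[of "Suc m" k y] dim_constant_terms_ge[OF ge, of k y] that by simp
  have y: "?d (m' + j) y = ?d m' y + j * ?\<chi>" for j
    using mn' by (induction j) (simp_all add: takiff_centralizer_dim_eq dim_commutant_Suc c)
  have "(INF z\<in>{z. jet m' z = jet m' y}. ?d n' z) = ?d m' y + (n' - m') * ?\<chi>"
  proof (rule cInf_eq_minimum)
    show "?d m' y + (n' - m') * ?\<chi> \<in> ?d n' ` {z. jet m' z = jet m' y}"
      using y[of "n' - m'"] mn' by (intro image_eqI[of _ _ y]) simp_all
  next
    fix l assume "l \<in> ?d n' ` {z. jet m' z = jet m' y}"
    then obtain z where "l = ?d n' z" "jet m' z = jet m' y" by blast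
    then show "?d m' y + (n' - m') * ?\<chi> \<le> l"
      using takiff_centralizer_dim_add_le[OF ge, of m' z "n' - m'"] mn'
        takiff_centralizer_dim_cong[of m' z y scale br] by simp
  qed
  then show "modality scale br m' n' y = int ((n' - m') * ?\<chi>)"
    by (simp add: modality_def)
qed

end
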